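(* Let $\mathbb{F}$ be an algebraically closed field of characteristic $3$. The derivation algebras of the $2$-dimensional evolution algebras $E_1(b,c)$ ($b,c\in\mathbb{F}$, $bc\ne1$), $E_2(b)$ ($b\in\mathbb{F}$), $E_3$, $E_4$, $E_5$, $E_6$ over $\mathbb{F}$ are as follows: \begin{itemize} \item $Der(E_1(b,c))=\{0\}$; \item $Der(E_2(b))=\{0\}$ if $b\neq0$; \item $Der(E_2(0))=\left\{\begin{pmatrix}0&0\\t&-t\end{pmatrix}: t\in\mathbb{F}\right\}$; \item $Der(E_3)=\left\{\begin{pmatrix}2t&0\\0&t\end{pmatrix}: t\in\mathbb{F}\right\}$; \item $Der(E_4)=\{0\}$; \item $Der(E_5)=\left\{\begin{pmatrix}-t&t\\t&-t\end{pmatrix}: t\in\mathbb{F}\right\}$; \item $Der(E_6)=\left\{\begin{pmatrix}2t&s\\0&t\end{pmatrix}: t,s\in\mathbb{F}\right\}$. \end{itemize}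
   Context: A $2$-dimensional algebra over $\mathbb{F}$ with basis $(e_1,e_2)$ and $e_i\cdot e_j=A^1_{i,j}e_1+A^2_{i,j}e_2$ is identified with its matrix of structure constants $$A=\begin{pmatrix} A^1_{1,1}&A^1_{1,2}&A^1_{2,1}&A^1_{2,2}\\ A^2_{1,1}&A^2_{1,2}&A^2_{2,1}&A^2_{2,2}\end{pmatrix},$$ so that in coordinate column vectors the product of $u$ and $v$ is $A(u\otimes v)$ (Kronecker product). The algebras considered (up to isomorphism, all the nontrivial $2$-dimensional evolution algebras over $\mathbb{F}$, i.e. algebras with nonzero multiplication having a basis with $e_1e_2=e_2e_1=0$) are $$E_{1}(b,c)=\begin{pmatrix} 1 & 0 & 0 & b\\ c & 0 & 0 & 1\end{pmatrix}\ (bc\neq1),\quad E_{2}(b)=\begin{pmatrix} 1 & 0 & 0 & b\\ 1 & 0 & 0 & 0\end{pmatrix},\quad E_{3}=\begin{pmatrix} 0 & 0 & 0 & 1\\ 1 & 0 & 0 & 0\end{pmatrix},$$ $$E_{4}=\begin{pmatrix} 1 & 0 & 0 & 1\\ 0 & 0 & 0 & 0\end{pmatrix},\quad E_5=\begin{pmatrix} 1 & 0 & 0 & -1\\ -1 & 0 & 0 & 1\end{pmatrix},\quad E_{6}=\begin{pmatrix} 0 & 0 & 0 & 1\\ 0 & 0 & 0 & 0\end{pmatrix}.$$ For an algebra with matrix of structure constants $E$, its algebra of derivations is $Der(E)=\{D\in M(2;\mathbb{F}):\ E(D\otimes I+I\otimes D)-DE=0\}$, where $M(2;\mathbb{F})$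 is the set of $2\times2$ matrices over $\mathbb{F}$ and $I$ is the $2\times 2$ identity matrix. *)

theory Defs
  imports
    "HOL-Computational_Algebra.Computational_Algebra"
    "Jordan_Normal_Form.Matrix"
begin

definition kronecker :: "'a :: times mat \<Rightarrow> 'a mat \<Rightarrow> 'a mat" where
  "kronecker A B =
     mat (dim_row A * dim_row B) (dim_col A * dim_col B)
       (\<lambda>(i, j). A $$ (i div dim_row B, j div dim_col B) * B $$ (i mod dim_row B, j mod dim_col B))"

text \<open>
  A 2-dimensional algebra with basis \<open>e\<^sub>1, e\<^sub>2\<close> is given by its matrix of structure constants,
  a \<open>2 \<times> 4\<close> matrix whose columns are the coordinates of
  \<open>e\<^sub>1e\<^sub>1, e\<^sub>1e\<^sub>2, e\<^sub>2e\<^sub>1, e\<^sub>2e\<^sub>2\<close>, in this order.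
\<close>

definition E1 :: "'a :: field \<Rightarrow> 'a \<Rightarrow> 'a mat" where
  "E1 b c = mat_of_rows_list 4 [[1, 0, 0, b], [c, 0, 0, 1]]"

definition E2 :: "'a :: field \<Rightarrow> 'a mat" where
  "E2 b = mat_of_rows_list 4 [[1, 0, 0, b], [1, 0, 0, 0]]"

definition E3 :: "'a :: field mat" where
  "E3 = mat_of_rows_list 4 [[0, 0, 0, 1], [1, 0, 0, 0]]"

definition E4 :: "'a :: field mat" where
  "E4 = mat_of_rows_list 4 [[1, 0, 0, 1], [0, 0, 0, 0]]"

definition E5 :: "'a :: field mat" where
  "E5 = mat_of_rows_list 4 [[1, 0, 0, - 1], [- 1, 0, 0, 1]]"

definition E6 :: "'a :: field mat" where
  "E6 = mat_of_rows_list 4 [[0, 0, 0, 1], [0, 0, 0, 0]]"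

definition Der :: "'a :: field mat \<Rightarrow> 'a mat set" where
  "Der E = {D \<in> carrier_mat 2 2.
     E * (kronecker D (1\<^sub>m 2) + kronecker (1\<^sub>m 2) D) - D * E = 0\<^sub>m 2 4}"

end

(* Writing e1 e1 = p e1 + q e2, e2 e2 = r e1 + s e2 and e1 e2 = e2 e1 = 0, a matrix D with rows
   (x, y) and (z, w) is a derivation iff D(e1 e1) = 2x e1 e1, D(e2 e2) = 2w e2 e2 and
   y e1 e1 + z e2 e2 = 0. These six scalar equations are solved in each case; characteristic 3
   enters through 2 being invertible (E4) and 2 * 2 = 1 (E3). *)

theory Submission
  imports Defs
begin

lemma carrier_mat_2_eq:
  assumes "D \<in> carrier_mat 2 2"
  shows "D = mat_of_rows_list 2 [[D $$ (0,0), D $$ (0,1)], [D $$ (1,0), D $$ (1,1)]]"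
  using assms by (intro eq_matI) (auto simp: mat_of_rows_list_def less_Suc_eq less_2_cases_iff)

lemma mat_of_rows_list_2_eq_iff:
  "mat_of_rows_list 2 [[x, y], [z, w]] = mat_of_rows_list 2 [[x', y'], [z', w']] \<longleftrightarrow>
    x = x' \<and> y = y' \<and> z = z' \<and> w = w'"
  by (auto simp: mat_of_rows_list_def mat_eq_iff less_Suc_eq less_2_cases_iff)

text \<open>A matrix outside the carrier lies in neither set, and one inside it is determined by its
  four entries. So each computation of a derivation algebra becomes an equivalence between scalar
  conditions on \<open>x\<close>, \<open>y\<close>, \<open>z\<close>, \<open>w\<close>.\<close>

lemma mat_2_2_set_eqI:
  assumes "A \<subseteq> carrier_mat 2 2" "B \<subseteq> carrier_mat 2 2"
    and "\<And>x y z w. mat_of_rows_list 2 [[x, y], [z, w]] \<in> A \<longleftrightarrow>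
      mat_of_rows_list 2 [[x, y], [z, w]] \<in> B"
  shows "A = B"
proof (rule Set.set_eqI)
  fix D
  show "D \<in> A \<longleftrightarrow> D \<in> B"
  proof (cases "D \<in> carrier_mat 2 2")
    case True
    show ?thesis
      by (subst (1 2) carrier_mat_2_eq [OF True]) (rule assms(3))
  qed (use assms in auto)
qed

lemma zero_mat_2_2: "0\<^sub>m 2 2 = mat_of_rows_list 2 [[0, 0], [0, 0]]"
  by (intro eq_matI) (auto simp: mat_of_rows_list_def less_Suc_eq less_2_cases_iff)

lemma zero_mat_2_4_iff:
  "mat_of_rows_list 4 [[a, b, c, d], [e, f, g, h]] = 0\<^sub>m 2 4 \<longleftrightarrow>
    a = 0 \<and> b = 0 \<and> c = 0 \<and> d = 0 \<and> e = 0 \<and> f = 0 \<and> g = 0 \<and> h = 0"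
    (is "?M = _ \<longleftrightarrow> _")
proof -
  \<comment> \<open>Explicit finite index sets let the quantifiers unfold into eight entry
    equations.\<close>
  have "?M = 0\<^sub>m 2 4 \<longleftrightarrow> (\<forall>i\<in>{0, 1}. \<forall>j\<in>{0, 1, 2, 3}. ?M $$ (i, j) = 0)"
  proof
    assume "\<forall>i\<in>{0, 1}. \<forall>j\<in>{0, 1, 2, 3}. ?M $$ (i, j) = 0"
    then show "?M = 0\<^sub>m 2 4"
    proof (intro eq_matI)
      fix i j assume "\<forall>i\<in>{0, 1}. \<forall>j\<in>{0, 1, 2, 3}. ?M $$ (i, j) = 0"
        and "i < dim_row (0\<^sub>m 2 4 :: 'a mat)" "j < dim_col (0\<^sub>m 2 4 :: 'a mat)"
      moreover from this have "i \<in> {0, 1}" "j \<in> {0, 1, 2, 3}"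
        by auto
      ultimately show "?M $$ (i, j) = 0\<^sub>m 2 4 $$ (i, j)"
        by auto
    qed (simp_all add: mat_of_rows_list_def)
  qed simp
  then show ?thesis
    by (simp add: mat_of_rows_list_def conj_assoc)
qed

lemma mat_of_rows_list_2_carrier: "mat_of_rows_list 2 [[x, y], [z, w]] \<in> carrier_mat 2 2"
  by (simp add: mat_of_rows_list_def numeral_2_eq_2)

lemma Der_subset_carrier: "Der E \<subseteq> carrier_mat 2 2"
  by (auto simp: Der_def)

text \<open>All six families are instances with particular \<open>p\<close>, \<open>q\<close>,
  \<open>r\<close>, \<open>s\<close>, so the matrix computation is done once, for a generic
  evolution algebra.\<close>

lemma mem_Der_evolution_iff:
  fixes p q r s x y z w :: "'a :: field"
  shows "mat_of_rows_list 2 [[x, y], [z, w]] \<in> Der (mat_of_rows_list 4 [[p, 0, 0, r], [q, 0, 0, s]])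
    \<longleftrightarrow> 2 * x * p = p * x + q * y \<and> 2 * x * q = p * z + q * w
      \<and> 2 * w * r = r * x + s * y \<and> 2 * w * s = r * z + s * w
      \<and> y * p + z * r = 0 \<and> y * q + z * s = 0"
    (is "?D \<in> Der ?E \<longleftrightarrow> _")
proof -
  have sum_4: "sum f {0..<4} = f 0 + f 1 + f 2 + f 3" for f :: "nat \<Rightarrow> 'a"
    by (simp add: eval_nat_numeral)
  have sum_2: "sum f {0..<2} = f 0 + f 1" for f :: "nat \<Rightarrow> 'a"
    by (simp add: eval_nat_numeral)
  \<comment> \<open>The Kronecker sum is the Leibniz action of \<open>?D\<close> on the tensor basis
    e1e1, e1e2, e2e1, e2e2.\<close>
  have K: "kronecker ?D (1\<^sub>m 2) + kronecker (1\<^sub>m 2) ?D =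
      mat_of_rows_list 4 [[2 * x, y, y, 0], [z, x + w, 0, y], [z, 0, x + w, y], [0, z, z, 2 * w]]"
    (is "_ = ?K")
  proof (rule eq_matI)
    fix i j assume "i < dim_row ?K" "j < dim_col ?K"
    then have "i = 0 \<or> i = 1 \<or> i = 2 \<or> i = 3" "j = 0 \<or> j = 1 \<or> j = 2 \<or> j = 3"
      by (auto simp: mat_of_rows_list_def)
    then show "(kronecker ?D (1\<^sub>m 2) + kronecker (1\<^sub>m 2) ?D) $$ (i, j) = ?K $$ (i, j)"
      by (elim disjE) (simp_all add: mat_of_rows_list_def kronecker_def numeral_2_eq_2 [symmetric])
  qed (simp_all add: mat_of_rows_list_def kronecker_def)
  \<comment> \<open>The two middle columns agree because both mixed products vanish; hence eight
    entries yield only six distinct equations.\<close>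
  have "?E * ?K - ?D * ?E =
      mat_of_rows_list 4
        [[2 * x * p - (p * x + q * y), y * p + z * r, y * p + z * r, 2 * w * r - (r * x + s * y)],
         [2 * x * q - (p * z + q * w), y * q + z * s, y * q + z * s, 2 * w * s - (r * z + s * w)]]"
    (is "_ = ?R")
  proof (rule eq_matI)
    fix i j assume "i < dim_row ?R" "j < dim_col ?R"
    then have "i = 0 \<or> i = 1" "j = 0 \<or> j = 1 \<or> j = 2 \<or> j = 3"
      by (auto simp: mat_of_rows_list_def)
    then show "(?E * ?K - ?D * ?E) $$ (i, j) = ?R $$ (i, j)"
      by (elim disjE)
        (simp_all add: mat_of_rows_list_def scalar_prod_def sum_4 sum_2 mult.commute)
  qed (simp_all add: mat_of_rows_list_def)
  then show ?thesis
    unfolding Der_def mem_Collect_eq K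
    by (simp only: mat_of_rows_list_2_carrier zero_mat_2_4_iff right_minus_eq) blast
qed

theorem theorem4p3:
  assumes "CHAR('a :: alg_closed_field) = 3"
  shows "(\<forall>b c :: 'a. b * c \<noteq> 1 \<longrightarrow> Der (E1 b c) = {0\<^sub>m 2 2}) \<and>
    (\<forall>b :: 'a. b \<noteq> 0 \<longrightarrow> Der (E2 b) = {0\<^sub>m 2 2}) \<and>
    Der (E2 (0 :: 'a)) = {mat_of_rows_list 2 [[0, 0], [t, - t]] | t. True} \<and>
    Der (E3 :: 'a mat) = {mat_of_rows_list 2 [[2 * t, 0], [0, t]] | t. True} \<and>
    Der (E4 :: 'a mat) = {0\<^sub>m 2 2} \<and>
    Der (E5 :: 'a mat) = {mat_of_rows_list 2 [[- t, t], [t, - t]] | t. True} \<and>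
    Der (E6 :: 'a mat) = {mat_of_rows_list 2 [[2 * t, s], [0, t]] | t s. True}"
proof (intro conjI allI impI)
  have "of_nat 3 = (0 :: 'a)"
    using assms of_nat_CHAR by metis
  then have three: "(3 :: 'a) = 0"
    by simp
  have "(4 :: 'a) = 3 + 1"
    by simp
  then have four: "(4 :: 'a) = 1"
    by (simp only: three add_0)
  have "(4 :: 'a) = 2 * 2"
    by simp
  \<comment> \<open>If 2 were 0, then 1 = 4 = 2 * 2 would be 0.\<close>
  with four have two: "(2 :: 'a) \<noteq> 0"
    by (metis mult_zero_left zero_neq_one)
  \<comment> \<open>This settles equations of the form 2x = x, which force x = 0.\<close>
  have two_neq_one: "(2 :: 'a) \<noteq> 1"
    by (metis add_cancel_right_right one_add_one zero_neq_one)
  note solve = mem_Der_evolution_iff mat_of_rows_list_2_eq_iff zero_mat_2_2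
  note carrier = Der_subset_carrier mat_of_rows_list_2_carrier
  show "Der (E1 b c) = {0\<^sub>m 2 2}" if "b * c \<noteq> 1" for b c :: 'a
  proof (rule mat_2_2_set_eqI)
    fix x y z w :: 'a
    \<comment> \<open>The equations from the mixed products form a homogeneous linear system in
      \<open>y\<close>, \<open>z\<close> with determinant 1 - bc. Once \<open>y\<close> vanishes, so
      does \<open>z\<close>, and the remaining equations reduce to 2x = x and 2w = w.\<close>
    have "y = 0" if "y + z * b = 0" "y * c + z = 0"
    proof -
      have "y * (1 - b * c) = 0"
        using that by (simp add: eq_neg_iff_add_eq_0 [symmetric] algebra_simps)
      with \<open>b * c \<noteq> 1\<close> show ?thesis
        by simp
    qed
    then show "mat_of_rows_list 2 [[x, y], [z, w]] \<in> Der (E1 b c) \<longleftrightarrow>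
        mat_of_rows_list 2 [[x, y], [z, w]] \<in> {0\<^sub>m 2 2}"
      by (auto simp: E1_def solve two_neq_one)
  qed (use carrier in auto)
  \<comment> \<open>Here bz = 0 gives z = 0, then y = 0, x = y and w = 2x - z eliminate the rest.
    For b = 0 the first of these is lost and only z + w = 0 constrains the second row.\<close>
  show "Der (E2 b) = {0\<^sub>m 2 2}" if "b \<noteq> 0" for b :: 'a
    by (rule mat_2_2_set_eqI) (use that carrier in \<open>auto simp: E2_def solve two_neq_one\<close>)
  show "Der (E2 (0 :: 'a)) = {mat_of_rows_list 2 [[0, 0], [t, - t]] | t. True}"
    by (rule mat_2_2_set_eqI)
      (use carrier in \<open>auto simp: E2_def solve two_neq_one add_eq_0_iff\<close>)
  \<comment> \<open>The diagonal satisfies both x = 2w and w = 2x, which are equivalent because 4 =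
    1.\<close>
  show "Der (E3 :: 'a mat) = {mat_of_rows_list 2 [[2 * t, 0], [0, t]] | t. True}"
    by (rule mat_2_2_set_eqI) (use carrier in \<open>auto simp: E3_def solve four\<close>)
  show "Der (E4 :: 'a mat) = {0\<^sub>m 2 2}"
    by (rule mat_2_2_set_eqI) (use carrier two in \<open>auto simp: E4_def solve two_neq_one\<close>)
  show "Der (E5 :: 'a mat) = {mat_of_rows_list 2 [[- t, t], [t, - t]] | t. True}"
  proof (rule mat_2_2_set_eqI)
    fix x y z w :: 'a
    have "mat_of_rows_list 2 [[x, y], [z, w]] \<in> Der (E5 :: 'a mat) \<longleftrightarrow>
        x = - y \<and> z = y \<and> w = - y"
    proof
      assume D: "mat_of_rows_list 2 [[x, y], [z, w]] \<in> Der (E5 :: 'a mat)"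
      \<comment> \<open>Three of the six equations already determine \<open>x\<close>,
        \<open>z\<close>, \<open>w\<close> from \<open>y\<close> by cancellation alone; the converse
        direction checks that the others then hold too.\<close>
      have "2 * x * 1 = 1 * x + - 1 * y" and "2 * x * - 1 = 1 * z + - 1 * w"
        and "y * 1 + z * - 1 = 0"
        using D unfolding E5_def mem_Der_evolution_iff by blast+
      then have x_eq: "x + x = x + - y" and w_eq: "- (x + x) = z + - w" and "y + - z = 0"
        by (simp_all only: mult_1_left mult_1_right mult_minus1 mult_minus1_right mult_2)
      then have z: "z = y"
        by (simp only: add_eq_0_iff2 minus_minus)
      from x_eq have x: "x = - y"
        by (simp only: add_left_cancel)
      from w_eq have "y = - w"
        by (simp only: x z minus_add_distrib minus_minus add_left_cancel)
      with x z show "x = - y \<and> z = y \<and> w = - y"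
        by simp
    next
      assume "x = - y \<and> z = y \<and> w = - y"
      then show "mat_of_rows_list 2 [[x, y], [z, w]] \<in> Der (E5 :: 'a mat)"
        by (simp add: E5_def mem_Der_evolution_iff)
    qed
    then show "mat_of_rows_list 2 [[x, y], [z, w]] \<in> Der (E5 :: 'a mat) \<longleftrightarrow>
        mat_of_rows_list 2 [[x, y], [z, w]] \<in> {mat_of_rows_list 2 [[- t, t], [t, - t]] | t. True}"
      by (auto simp: mat_of_rows_list_2_eq_iff)
  qed (use carrier in auto)
  show "Der (E6 :: 'a mat) = {mat_of_rows_list 2 [[2 * t, s], [0, t]] | t s. True}"
    by (rule mat_2_2_set_eqI) (use carrier in \<open>auto simp: E6_def solve\<close>)
qed

end
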